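(* Let $E$ be a Polish space, let $(P_t)_{t\ge 0}$ be a semigroup of Markov kernels on $E$, and let $\mu$ be a probability measure on $E$. Assume that: (1) $P_t$ is strong Feller for every $t>0$, and for every $f\in C_b(E)$ the map $[0,\infty)\times E\ni(t,x)\mapsto P_tf(x)\in\mathbb{R}$ is jointly continuous; (2) $X^\mu=(X_t)_{t\ge0}$ is an $E$-valued temporally homogeneous Markov process on a filtered probability space $(\Omega,\mathcal{F},(\mathcal{F}_t)_{t\ge 0},\mathbb{P}^\mu)$, with a.s. càdlàg paths in $E$, transition function $(P_t)_{t\ge0}$ and initial distribution $\mu$; (3) $N\subset E$ is a closed set such that $$\mu(N)=0,\qquad P_t(N,x)=0\ \text{ for all } t>0,\ x\in E,\qquad \mathbb{P}^\mu(T_N<\infty)>0,$$ where $T_N:=\inf\{t>0: X_t\in N\}$. Set $F:=E\setminus N$ with the trace topology and Borel $\sigma$-algebra $\mathcal{B}(F)$, and $$Q_t(A,x):=P_t(A,x)\qquad\text{for all } t\ge0,\ x\in F,\ A\in\mathcal{B}(F).$$ Then: (a) $F$ is a Polish space; (b) $(Q_t)_{t\ge0}$ is a semigroup of Markov kernels on $F$, $Q_t$ is strong Feller on $F$ for every $t>0$, and for every $f\in C_b(F)$ the map $[0,\infty)\times F\ni(t,x)\mapsto Q_tf(x)\in\mathbb{R}$ is jointly continuous; (c) there exists no $F$-valued temporally homogeneous Markov process (on any filtered probability space) with a.s. càdlàg paths in $F$, transition function $(Q_t)_{t\ge0}$ and initial distribution $\mu|_F$.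
   Context: A Polish space is a topological space homeomorphic to a complete separable metric space; it is endowed with its Borel $\sigma$-algebra $\mathcal{B}(E)$. $C_b(E)$ and $\mathcal{B}_b(E)$ denote the real-valued bounded continuous, respectively bounded Borel measurable, functions on $E$. For a kernel, $P_t(A,x)$ is the mass of $A\in\mathcal{B}(E)$ under the measure attached to the point $x$, and $P_tf(x)=\int_E f(y)\,P_t(dy,x)$. Markov kernel means $P_t(E,x)=1$ for all $x$. A semigroup of Markov kernels satisfies $P_{t+s}=P_tP_s$ and $P_0=\mathrm{Id}$ (that is, $P_0(\cdot,x)=\delta_x$). $P_t$ is strong Feller if $P_tf\in C_b(E)$ for every $f\in\mathcal{B}_b(E)$. A process $(X_t)_{t\ge0}$ on a filtered probability space $(\Omega,\mathcal{F},(\mathcal{F}_t),\mathbb{P})$ is a temporally homogeneous Markov process with transition function $(P_t)_{t\ge0}$ and initial distribution $\mu$ if it is $(\mathcal{F}_t)$-adapted, $\mathbb{P}\circ X_0^{-1}=\mu$, and $\mathbb{E}[f(X_{t+s})\mid\mathcal{F}_t]=P_sf(X_t)$ a.s. for all $s,t\ge0$ and all $f\in\mathcal{B}_b(E)$. The same definitions are used with $F$, $(Q_t)$, $\mu|_F$. Càdlàg paths in a space $S$ means right-continuous on $[0,\infty)$ with left limits existing in $S$ at every $t>0$. The filtration of the given process $X^\mu$ is taken right-continuous and complete with respect to $\mathbb{P}^\mu$ (no loss of generality), so that the hitting time $T_N$ is an $(\mathcal{F}_t)$-stopping time. *)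

theory Defs
  imports "HOL-Probability.Probability"
begin

definition Polish_space :: "'a topology \<Rightarrow> bool" where
  "Polish_space X \<longleftrightarrow> completely_metrizable_space X \<and> separable_space X"

definition borel_of :: "'a topology \<Rightarrow> 'a measure" where
  "borel_of X = sigma (topspace X) {U. openin X U}"

definition bounded_continuous :: "'a topology \<Rightarrow> ('a \<Rightarrow> real) set" where
  "bounded_continuous X = {f. continuous_map X euclideanreal f \<and> bounded (f ` topspace X)}"

definition bounded_borel :: "'a topology \<Rightarrow> ('a \<Rightarrow> real) set" where
  "bounded_borel X = {f \<in> borel_measurable (borel_of X). bounded (f ` topspace X)}"

text \<open>
  A kernel at time \<open>t\<close> is a map \<open>P t\<close> from points to measures, so that the mass
  \<open>P\<^sub>t(A, x)\<close> is \<open>emeasure (P t x) A\<close>. Only \<open>t \<ge> 0\<close> and points of \<open>topspace X\<close> are relevant.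
\<close>

definition kernel_op :: "('a \<Rightarrow> 'a measure) \<Rightarrow> ('a \<Rightarrow> real) \<Rightarrow> 'a \<Rightarrow> real" where
  "kernel_op K f x = (\<integral>y. f y \<partial>K x)"

definition markov_kernel :: "'a topology \<Rightarrow> ('a \<Rightarrow> 'a measure) \<Rightarrow> bool" where
  "markov_kernel X K \<longleftrightarrow> K \<in> borel_of X \<rightarrow>\<^sub>M prob_algebra (borel_of X)"

definition markov_semigroup :: "'a topology \<Rightarrow> (real \<Rightarrow> 'a \<Rightarrow> 'a measure) \<Rightarrow> bool" where
  "markov_semigroup X P \<longleftrightarrow>
     (\<forall>t\<ge>0. markov_kernel X (P t)) \<and>
     (\<forall>x\<in>topspace X. P 0 x = return (borel_of X) x) \<and>
     (\<forall>t\<ge>0. \<forall>s\<ge>0. \<forall>x\<in>topspace X. P (t + s) x = Giry_Monad.bind (P t x) (P s))"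

definition strong_feller :: "'a topology \<Rightarrow> ('a \<Rightarrow> 'a measure) \<Rightarrow> bool" where
  "strong_feller X K \<longleftrightarrow> (\<forall>f\<in>bounded_borel X. kernel_op K f \<in> bounded_continuous X)"

definition jointly_continuous_semigroup ::
    "'a topology \<Rightarrow> (real \<Rightarrow> 'a \<Rightarrow> 'a measure) \<Rightarrow> bool" where
  "jointly_continuous_semigroup X P \<longleftrightarrow>
     (\<forall>f\<in>bounded_continuous X.
        continuous_map (prod_topology (top_of_set {0..}) X) euclideanreal
          (\<lambda>(t, x). kernel_op (P t) f x))"

text \<open>
  The time set is \<open>[0, \<infinity>)\<close>, encoded by restricting a real index to \<open>t \<ge> 0\<close>; the library locale
  \<open>filtration\<close> would impose conditions at negative times. Neither completeness nor
  right-continuity is part of a filtered probability space.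
\<close>

definition filtered_prob_space :: "'w measure \<Rightarrow> (real \<Rightarrow> 'w measure) \<Rightarrow> bool" where
  "filtered_prob_space M \<F> \<longleftrightarrow>
     prob_space M \<and>
     (\<forall>t\<ge>0. subalgebra M (\<F> t)) \<and>
     (\<forall>s\<ge>0. \<forall>t\<ge>s. sets (\<F> s) \<subseteq> sets (\<F> t))"

definition usual_conditions :: "'w measure \<Rightarrow> (real \<Rightarrow> 'w measure) \<Rightarrow> bool" where
  "usual_conditions M \<F> \<longleftrightarrow>
     complete_measure M \<and> null_sets M \<subseteq> sets (\<F> 0) \<and>
     (\<forall>t\<ge>0. sets (\<F> t) = (\<Inter>s\<in>{t<..}. sets (\<F> s)))"

definition markov_process ::
    "'a topology \<Rightarrow> (real \<Rightarrow> 'a \<Rightarrow> 'a measure) \<Rightarrow> 'a measure \<Rightarrow>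
     'w measure \<Rightarrow> (real \<Rightarrow> 'w measure) \<Rightarrow> (real \<Rightarrow> 'w \<Rightarrow> 'a) \<Rightarrow> bool" where
  "markov_process S P \<mu> M \<F> X \<longleftrightarrow>
     filtered_prob_space M \<F> \<and>
     (\<forall>t\<ge>0. X t \<in> \<F> t \<rightarrow>\<^sub>M borel_of S) \<and>
     distr M (borel_of S) (X 0) = \<mu> \<and>
     (\<forall>t\<ge>0. \<forall>s\<ge>0. \<forall>f\<in>bounded_borel S.
        AE \<omega> in M. real_cond_exp M (\<F> t) (\<lambda>\<omega>. f (X (t + s) \<omega>)) \<omega> = kernel_op (P s) f (X t \<omega>))"

text \<open>
  \<open>limitin S\<close> demands that the limit lies in \<open>topspace S\<close>; thus left limits exist inside \<open>S\<close>.
\<close>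

definition cadlag :: "'a topology \<Rightarrow> (real \<Rightarrow> 'a) \<Rightarrow> bool" where
  "cadlag S x \<longleftrightarrow>
     (\<forall>t\<ge>0. limitin S x (x t) (at_right t)) \<and>
     (\<forall>t>0. \<exists>l. limitin S x l (at_left t))"

definition hitting_time :: "(real \<Rightarrow> 'w \<Rightarrow> 'a) \<Rightarrow> 'a set \<Rightarrow> 'w \<Rightarrow> ereal" where
  "hitting_time X N \<omega> = Inf {ereal t |t. t > 0 \<and> X t \<omega> \<in> N}"

text \<open>
  For \<open>F\<close> Borel and \<open>x \<in> F\<close>, the measure \<open>restrict_kernel P F t x\<close> lives on the trace
  \<open>\<sigma>\<close>-algebra of \<open>F\<close> and assigns to its members \<open>A\<close> the mass \<open>P\<^sub>t(A, x)\<close>.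
\<close>

definition restrict_kernel ::
    "(real \<Rightarrow> 'a \<Rightarrow> 'a measure) \<Rightarrow> 'a set \<Rightarrow> real \<Rightarrow> 'a \<Rightarrow> 'a measure" where
  "restrict_kernel P F t x = restrict_space (P t x) F"

end

theory Submission
  imports Defs
begin

text \<open>
  Write \<open>F\<close> for the complement of the closed set \<open>N\<close>. Two observations carry the theorem.

  Regularity of the restricted semigroup. Since \<open>P\<^sub>t\<close> does not charge \<open>N\<close>, the restricted kernels
  \<open>Q\<^sub>t\<close> keep total mass \<open>1\<close> and the semigroup law. For a function on \<open>F\<close>, let \<open>f\<close> be its extension by
  zero to \<open>E\<close>; then \<open>Q\<^sub>t\<close> applied to the function is \<open>P\<^sub>t f\<close> on \<open>F\<close>. The extension is in general only
  Borel, not continuous, but for \<open>t > 0\<close> the strong Feller property repairs this: \<open>P\<^sub>t f = P\<^sub>t\<^sub>-\<^sub>u (P\<^sub>u f)\<close> with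
  \<open>P\<^sub>u f\<close> continuous on all of \<open>E\<close>. At \<open>t = 0\<close> only continuity of the extension at the point in
  question matters, because \<open>P\<^sub>s(\<cdot>, y)\<close> concentrates near \<open>x\<close> as \<open>(s, y)\<close> tends to \<open>(0, x)\<close>
  (lemma \<open>strong_feller_joint_continuity\<close>).

  Non-existence of the process. A path that is cadlag as a path in \<open>F\<close> has its values and its left
  limits in \<open>F\<close>, so on a bounded time interval it keeps away from \<open>N\<close>: if \<open>C\<^sub>0 \<subseteq> C\<^sub>1 \<subseteq> \<dots>\<close> are
  closed sets whose interiors exhaust \<open>F\<close>, then the path stays in a single \<open>C\<^sub>k\<close> (lemma
  \<open>cadlag_range_in_exhaustion\<close>). Staying in some \<open>C\<^sub>k\<close> at all dyadic times up to \<open>T\<close> is an event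
  about countably many coordinates, and its probability is determined by the initial
  distribution and the transition function (lemma \<open>dyadic_stay_prob_LIMSEQ\<close>). A process \<open>Y\<close> in \<open>F\<close>
  and the given process \<open>X\<close> in \<open>E\<close> have the same such data, as far as sets \<open>C \<subseteq> F\<close> are concerned,
  so \<open>X\<close> too stays almost surely in some \<open>C\<^sub>k\<close> at dyadic times. By right continuity \<open>X\<close> then
  never visits \<open>N\<close> (lemma \<open>cadlag_avoids_if_dyadic_values_avoid\<close>), against the assumption that it
  does so with positive probability.
\<close>

section \<open>Borel structure of topological spaces and their open subspaces\<close>

lemma space_borel_of [simp]: "space (borel_of X) = topspace X"
  unfolding borel_of_def by (rule space_measure_of) (auto dest: openin_subset)

lemma sets_borel_of: "sets (borel_of X) = sigma_sets (topspace X) {U. openin X U}"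
  unfolding borel_of_def by (rule sets_measure_of) (auto dest: openin_subset)

lemma borel_of_open: "openin X U \<Longrightarrow> U \<in> sets (borel_of X)"
  by (auto simp: sets_borel_of)

lemma borel_of_closed: "closedin X C \<Longrightarrow> C \<in> sets (borel_of X)"
  using sets.compl_sets[OF borel_of_open[of X "topspace X - C"]]
  by (simp add: closedin_def double_diff)

lemma borel_of_subtopology:
  assumes "F \<in> sets (borel_of X)"
  shows "sets (borel_of (subtopology X F)) = sets (restrict_space (borel_of X) F)"
proof -
  have F: "F \<subseteq> topspace X"
    using sets.sets_into_space[OF assms] by simp
  have "{U. openin (subtopology X F) U} = (\<inter>) F ` {U. openin X U}"
    by (auto simp: openin_subtopology)
  moreover have "topspace (subtopology X F) = F"
    using F by auto
  ultimately show ?thesis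
    using assms F by (simp add: sets_borel_of sets_restrict_space sigma_sets_Int)
qed

lemma borel_measurable_continuous_map:
  assumes "continuous_map X euclideanreal f"
  shows "f \<in> borel_measurable (borel_of X)"
proof (rule borel_measurableI)
  fix S :: "real set" assume "open S"
  then have "openin X {x \<in> topspace X. f x \<in> S}"
    using assms by (simp add: continuous_map_def)
  moreover have "f -` S \<inter> space (borel_of X) = {x \<in> topspace X. f x \<in> S}"
    by auto
  ultimately show "f -` S \<inter> space (borel_of X) \<in> sets (borel_of X)"
    using borel_of_open by metis
qed

lemma bounded_continuous_subset_bounded_borel: "bounded_continuous X \<subseteq> bounded_borel X"
  by (auto simp: bounded_continuous_def bounded_borel_def borel_measurable_continuous_map)

lemma bounded_continuous_cong:
  assumes "\<And>x. x \<in> topspace X \<Longrightarrow> f x = g x"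
  shows "f \<in> bounded_continuous X \<longleftrightarrow> g \<in> bounded_continuous X"
proof -
  have "f ` topspace X = g ` topspace X"
    using assms by auto
  moreover have "continuous_map X euclideanreal f \<longleftrightarrow> continuous_map X euclideanreal g"
    using assms by (metis continuous_map_eq)
  ultimately show ?thesis
    by (simp add: bounded_continuous_def)
qed

lemma bounded_borel_bound:
  assumes "f \<in> bounded_borel X"
  obtains B where "B \<ge> 0" "\<And>x. x \<in> topspace X \<Longrightarrow> \<bar>f x\<bar> \<le> B"
proof -
  obtain B where "\<forall>x\<in>topspace X. \<bar>f x\<bar> \<le> B"
    using assms by (auto simp: bounded_borel_def bounded_iff)
  then show thesis
    by (intro that[of "max B 0"]) force+
qed

lemma bounded_borelI:
  assumes "f \<in> borel_measurable (borel_of X)" "\<And>x. x \<in> topspace X \<Longrightarrow> \<bar>f x\<bar> \<le> B"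
  shows "f \<in> bounded_borel X"
  using assms by (auto simp: bounded_borel_def bounded_iff)

lemma indicator_bounded_borel:
  assumes "C \<in> sets (borel_of X)"
  shows "(indicator C :: 'a \<Rightarrow> real) \<in> bounded_borel X"
  using assms by (intro bounded_borelI[of _ _ 1]) auto

lemma bounded_borel_times:
  assumes "f \<in> bounded_borel X" "g \<in> bounded_borel X"
  shows "(\<lambda>x. f x * g x) \<in> bounded_borel X"
proof -
  obtain A where A: "A \<ge> 0" "\<And>x. x \<in> topspace X \<Longrightarrow> \<bar>f x\<bar> \<le> A"
    using bounded_borel_bound[OF assms(1)] by metis
  obtain B where B: "B \<ge> 0" "\<And>x. x \<in> topspace X \<Longrightarrow> \<bar>g x\<bar> \<le> B"
    using bounded_borel_bound[OF assms(2)] by metis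
  show ?thesis
  proof (rule bounded_borelI)
    show "(\<lambda>x. f x * g x) \<in> borel_measurable (borel_of X)"
      using assms by (auto simp: bounded_borel_def)
    show "\<bar>f x * g x\<bar> \<le> A * B" if "x \<in> topspace X" for x
      using A B that by (auto simp: abs_mult intro!: mult_mono)
  qed
qed

lemma bounded_borel_extend_by_zero:
  assumes F: "F \<in> sets (borel_of X)" and f: "f \<in> bounded_borel (subtopology X F)"
  shows "(\<lambda>x. indicator F x * f x) \<in> bounded_borel X"
proof -
  obtain B where B: "B \<ge> 0" "\<And>x. x \<in> topspace (subtopology X F) \<Longrightarrow> \<bar>f x\<bar> \<le> B"
    using bounded_borel_bound[OF f] by metis
  have "f \<in> borel_measurable (borel_of (subtopology X F))"
    using f by (simp add: bounded_borel_def)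
  then have "f \<in> borel_measurable (restrict_space (borel_of X) F)"
    using borel_of_subtopology[OF F] measurable_cong_sets by blast
  moreover have "F \<inter> space (borel_of X) \<in> sets (borel_of X)"
    using F by (intro sets.Int sets.top)
  ultimately have "(\<lambda>x. indicator F x *\<^sub>R f x) \<in> borel_measurable (borel_of X)"
    using borel_measurable_restrict_space_iff by blast
  then show ?thesis
    using B by (intro bounded_borelI[of _ _ B]) (auto simp: indicator_def)
qed

lemma continuous_map_real_iff:
  "continuous_map X euclideanreal f \<longleftrightarrow>
     (\<forall>x\<in>topspace X. \<forall>\<epsilon>>0. \<exists>U. openin X U \<and> x \<in> U \<and> (\<forall>y\<in>U. \<bar>f y - f x\<bar> < \<epsilon>))"
  using Met_TC.continuous_map_to_metric[of X f]
  by (simp add: dist_real_def abs_minus_commute)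

section \<open>Markov kernels\<close>

lemma markov_kernel_at:
  assumes "markov_kernel X K" "x \<in> topspace X"
  shows "prob_space (K x)" "sets (K x) = sets (borel_of X)" "space (K x) = topspace X"
proof -
  have "K x \<in> space (prob_algebra (borel_of X))"
    using assms measurable_space[of K "borel_of X" "prob_algebra (borel_of X)" x]
    by (simp add: markov_kernel_def)
  then show "prob_space (K x)" and s: "sets (K x) = sets (borel_of X)"
    by (auto simp: space_prob_algebra)
  show "space (K x) = topspace X"
    using sets_eq_imp_space_eq[OF s] by simp
qed

lemma integrable_bounded_borel:
  assumes "prob_space \<nu>" "sets \<nu> = sets (borel_of X)" "f \<in> bounded_borel X"
  shows "integrable \<nu> f"
proof -
  interpret prob_space \<nu> by fact
  obtain B where B: "\<And>x. x \<in> topspace X \<Longrightarrow> \<bar>f x\<bar> \<le> B"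
    using bounded_borel_bound[OF assms(3)] by metis
  have "space \<nu> = topspace X"
    using sets_eq_imp_space_eq[OF assms(2)] by simp
  moreover have "f \<in> borel_measurable \<nu>"
    using assms(2,3) measurable_cong_sets by (auto simp: bounded_borel_def)
  ultimately show ?thesis
    using B by (intro integrable_const_bound[of _ B]) (auto intro!: AE_I2)
qed

lemma kernel_op_bounded_borel:
  assumes K: "markov_kernel X K" and f: "f \<in> bounded_borel X"
  shows "kernel_op K f \<in> bounded_borel X"
proof -
  obtain B where B: "\<And>x. x \<in> topspace X \<Longrightarrow> \<bar>f x\<bar> \<le> B"
    using bounded_borel_bound[OF f] by metis
  show ?thesis
  proof (rule bounded_borelI)
    have "K \<in> borel_of X \<rightarrow>\<^sub>M subprob_algebra (borel_of X)"
      using K measurable_prob_algebraD by (auto simp: markov_kernel_def)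
    moreover have "f \<in> borel_measurable (borel_of X)"
      using f by (simp add: bounded_borel_def)
    ultimately have "(\<lambda>x. \<integral>y. f y \<partial>K x) \<in> borel_measurable (borel_of X)"
      using measurable_compose[OF _ integral_measurable_subprob_algebra] by blast
    then show "kernel_op K f \<in> borel_measurable (borel_of X)"
      by (simp add: kernel_op_def[abs_def])
    show "\<bar>kernel_op K f x\<bar> \<le> B" if x: "x \<in> topspace X" for x
    proof -
      interpret prob_space "K x" using markov_kernel_at(1)[OF K x] .
      have i: "integrable (K x) f"
        by (rule integrable_bounded_borel[OF _ markov_kernel_at(2)[OF K x] f]) unfold_locales
      have "\<bar>\<integral>y. f y \<partial>K x\<bar> \<le> (\<integral>y. \<bar>f y\<bar> \<partial>K x)"
        by (rule integral_abs_bound)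
      also have "\<dots> \<le> (\<integral>y. B \<partial>K x)"
        using i B markov_kernel_at(3)[OF K x] by (intro integral_mono) auto
      finally show ?thesis
        by (simp add: kernel_op_def prob_space)
    qed
  qed
qed

lemma kernel_op_add:
  assumes P: "markov_semigroup X P" and f: "f \<in> bounded_borel X"
    and "t \<ge> 0" "s \<ge> 0" and x: "x \<in> topspace X"
  shows "kernel_op (P (t + s)) f x = kernel_op (P t) (kernel_op (P s) f) x"
proof -
  have Pt: "markov_kernel X (P t)" and Ps: "markov_kernel X (P s)"
    using P assms by (auto simp: markov_semigroup_def)
  obtain B where B: "\<And>x. x \<in> topspace X \<Longrightarrow> \<bar>f x\<bar> \<le> B"
    using bounded_borel_bound[OF f] by metis
  interpret prob_space "P t x" by (rule markov_kernel_at(1)[OF Pt x])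
  have "P s \<in> P t x \<rightarrow>\<^sub>M subprob_algebra (borel_of X)"
    using Ps measurable_prob_algebraD markov_kernel_at(2)[OF Pt x]
    by (metis markov_kernel_def measurable_cong_sets)
  moreover have "AE y in P t x. emeasure (P s y) (space (P s y)) \<le> ennreal 1"
    using prob_space.emeasure_space_1[OF markov_kernel_at(1)[OF Ps]] markov_kernel_at(3)[OF Pt x]
    by (intro AE_I2) simp
  ultimately have "integral\<^sup>L (P t x \<bind> P s) f = (\<integral>y. integral\<^sup>L (P s y) f \<partial>P t x)"
    using f B by (intro integral_bind[of f "borel_of X" B "P s" "P t x" 1])
       (auto simp: bounded_borel_def intro: finite_measure_axioms)
  moreover have "P (t + s) x = P t x \<bind> P s"
    using P assms by (auto simp: markov_semigroup_def)
  ultimately show ?thesis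
    by (simp add: kernel_op_def)
qed

text \<open>
  The strong Feller property extends joint continuity from continuous to Borel functions \<open>f\<close>,
  except at time \<open>0\<close>, where \<open>P\<^sub>0 f = f\<close> has no more regularity than \<open>f\<close>. For \<open>t > 0\<close> half of the
  time is spent on smoothing: \<open>P\<^sub>s f = P\<^sub>s\<^sub>-\<^sub>u (P\<^sub>u f)\<close> with \<open>u = t / 2\<close>, for all \<open>s > u\<close>. For \<open>t = 0\<close>,
  take a continuous \<open>h\<close> with \<open>h x = 0\<close> and \<open>h = 1\<close> off a neighbourhood of \<open>x\<close> on which \<open>f\<close> hardly
  varies; then \<open>\<bar>f - f x\<bar>\<close> is bounded by a small constant plus a multiple of \<open>h\<close>, and \<open>P\<^sub>s h y\<close>
  tends to \<open>h x = 0\<close>.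
\<close>

lemma strong_feller_joint_continuity:
  assumes E: "metrizable_space E" and P: "markov_semigroup E P"
    and SF: "\<And>t. t > 0 \<Longrightarrow> strong_feller E (P t)"
    and JC: "jointly_continuous_semigroup E P"
    and f: "f \<in> bounded_borel E" and x: "x \<in> topspace E" and t: "t \<ge> 0" and \<epsilon>: "\<epsilon> > 0"
    and at_zero: "\<And>\<epsilon>. t = 0 \<Longrightarrow> \<epsilon> > 0 \<Longrightarrow> \<exists>U. openin E U \<and> x \<in> U \<and> (\<forall>y\<in>U. \<bar>f y - f x\<bar> < \<epsilon>)"
  shows "\<exists>A B. openin (top_of_set {0..}) A \<and> openin E B \<and> t \<in> A \<and> x \<in> B \<and>
           (\<forall>s\<in>A. \<forall>y\<in>B. \<bar>kernel_op (P s) f y - kernel_op (P t) f x\<bar> < \<epsilon>)"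
proof -
  have mk: "markov_kernel E (P s)" if "s \<ge> 0" for s
    using P that by (auto simp: markov_semigroup_def)
  \<comment> \<open>the joint continuity of the semigroup, in terms of product neighbourhoods\<close>
  have box: "\<exists>A B. openin (top_of_set {0..}) A \<and> openin E B \<and> u \<in> A \<and> x \<in> B \<and>
           (\<forall>s\<in>A. \<forall>y\<in>B. \<bar>kernel_op (P s) g y - kernel_op (P u) g x\<bar> < \<delta>)"
    if "g \<in> bounded_continuous E" "u \<ge> 0" "\<delta> > 0" for g u \<delta>
  proof -
    have "continuous_map (prod_topology (top_of_set {0..}) E) euclideanreal
          (\<lambda>(t, x). kernel_op (P t) g x)"
      using JC that by (simp add: jointly_continuous_semigroup_def)
    moreover have "(u, x) \<in> topspace (prod_topology (top_of_set {0..}) E)"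
      using that(2) x by simp
    ultimately obtain U where U: "openin (prod_topology (top_of_set {0..}) E) U" "(u, x) \<in> U"
      "\<And>z. z \<in> U \<Longrightarrow> \<bar>kernel_op (P (fst z)) g (snd z) - kernel_op (P u) g x\<bar> < \<delta>"
      using \<open>\<delta> > 0\<close> unfolding continuous_map_real_iff case_prod_beta by (metis fst_conv snd_conv)
    obtain A B where "openin (top_of_set {0..}) A" "openin E B" "u \<in> A" "x \<in> B" "A \<times> B \<subseteq> U"
      using U(1,2) unfolding openin_prod_topology_alt by meson
    then show ?thesis
      using U(3) by (metis fst_conv mem_Sigma_iff snd_conv subsetD)
  qed
  show ?thesis
  proof (cases "t = 0")
    case False
    define u where "u = t / 2"
    have u: "u > 0" "t = u + u"
      using False t by (auto simp: u_def)
    define g where "g = kernel_op (P u) f"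
    have "g \<in> bounded_continuous E"
      using SF[OF u(1)] f by (simp add: strong_feller_def g_def)
    then obtain A B where AB: "openin (top_of_set {0..}) A" "openin E B" "u \<in> A" "x \<in> B"
       "\<forall>s\<in>A. \<forall>y\<in>B. \<bar>kernel_op (P s) g y - kernel_op (P u) g x\<bar> < \<epsilon>"
      using box[of g u \<epsilon>] u \<epsilon> by auto
    obtain W where W: "open W" "A = {0..} \<inter> W"
      using AB(1) by (auto simp: openin_open)
    \<comment> \<open>the time neighbourhood of \<open>u\<close>, shifted by \<open>u\<close> and cut off so that \<open>s - u\<close> stays positive\<close>
    define A' where "A' = {u<..} \<inter> (+) u ` W"
    have "open A'"
      unfolding A'_def using W(1) by (intro open_Int open_translation) auto
    then have "openin (top_of_set {0..}) A'"
      using u(1) by (auto simp: openin_open A'_def intro!: exI[of _ A'])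
    moreover have "t \<in> A'"
      using AB(3) W(2) u by (auto simp: A'_def)
    moreover have "\<bar>kernel_op (P s) f y - kernel_op (P t) f x\<bar> < \<epsilon>" if sy: "s \<in> A'" "y \<in> B" for s y
    proof -
      obtain r where "r \<in> W" "s = u + r" "s > u"
        using sy(1) unfolding A'_def by blast
      then have r: "s = r + u" "r \<in> A" "r \<ge> 0"
        using W(2) by auto
      have "y \<in> topspace E"
        using sy(2) openin_subset[OF AB(2)] by auto
      then have "kernel_op (P s) f y = kernel_op (P r) g y"
        using kernel_op_add[OF P f] r u by (simp add: g_def)
      moreover have "kernel_op (P t) f x = kernel_op (P u) g x"
        using kernel_op_add[OF P f, of u u x] x u by (simp add: g_def)
      ultimately show ?thesis
        using AB(5) r sy by simp
    qed
    ultimately show ?thesis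
      using AB(2,4) by blast
  next
    case True
    have P0: "P 0 x = return (borel_of E) x"
      using P x by (simp add: markov_semigroup_def)
    have P0f: "kernel_op (P 0) g x = g x" if "g \<in> bounded_borel E" for g
      using that x by (simp add: kernel_op_def P0 integral_return bounded_borel_def)
    obtain U where U: "openin E U" "x \<in> U" "\<forall>y\<in>U. \<bar>f y - f x\<bar> < \<epsilon> / 2"
      using at_zero[OF True, of "\<epsilon> / 2"] \<epsilon> by auto
    obtain B where B: "B \<ge> 0" "\<And>x. x \<in> topspace E \<Longrightarrow> \<bar>f x\<bar> \<le> B"
      using bounded_borel_bound[OF f] by metis
    have "completely_regular_space E"
      by (simp add: E metrizable_imp_completely_regular_space)
    then obtain h where h: "continuous_map E (top_of_set {0..1::real}) h" "h x = 0" "h ` (topspace E - U) \<subseteq> {1}"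
      using U x unfolding completely_regular_space_def
      by (metis Diff_Diff_Int Diff_iff Int_iff closedin_def closedin_diff closedin_topspace)
    have h01: "0 \<le> h y" "h y \<le> 1" if "y \<in> topspace E" for y
      using h(1) that by (auto simp: continuous_map_def Pi_iff)
    have hc: "h \<in> bounded_continuous E"
      using h(1) h01 by (auto simp: bounded_continuous_def bounded_iff continuous_map_in_subtopology intro!: exI[of _ 1])
    then have hb: "h \<in> bounded_borel E"
      using bounded_continuous_subset_bounded_borel by blast
    have key: "\<bar>f y - f x\<bar> \<le> \<epsilon> / 2 + 2 * B * h y" if y: "y \<in> topspace E" for y
    proof (cases "y \<in> U")
      case True
      then show ?thesis
        using U(3) B(1) h01[OF y] by (smt (verit) mult_nonneg_nonneg)
    next
      case False
      then have "h y = 1" using h(3) y by auto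
      then show ?thesis
        using B(2)[OF x] B(2)[OF y] \<epsilon> by auto
    qed
    have est: "\<bar>kernel_op (P s) f y - f x\<bar> \<le> \<epsilon> / 2 + 2 * B * kernel_op (P s) h y"
      if s: "s \<ge> 0" and y: "y \<in> topspace E" for s y
    proof -
      note K = markov_kernel_at[OF mk[OF s] y]
      interpret prob_space "P s y" by (rule K(1))
      have i: "integrable (P s y) f" "integrable (P s y) h"
        using integrable_bounded_borel K f hb by blast+
      have "kernel_op (P s) f y - f x = (\<integral>z. f z - f x \<partial>P s y)"
        using i by (simp add: kernel_op_def prob_space)
      also have "\<bar>\<dots>\<bar> \<le> (\<integral>z. \<bar>f z - f x\<bar> \<partial>P s y)"
        by (rule integral_abs_bound)
      also have "\<dots> \<le> (\<integral>z. \<epsilon> / 2 + 2 * B * h z \<partial>P s y)"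
        using i key K(3) by (intro integral_mono) auto
      also have "\<dots> = \<epsilon> / 2 + 2 * B * kernel_op (P s) h y"
        using i by (simp add: kernel_op_def prob_space)
      finally show ?thesis .
    qed
    \<comment> \<open>small enough for \<open>2 * B * \<delta> < \<epsilon> / 2\<close>, also when \<open>B = 0\<close>\<close>
    define \<delta> where "\<delta> = \<epsilon> / (4 * B + 4)"
    have \<delta>: "\<delta> > 0" "2 * B * \<delta> < \<epsilon> / 2"
      using \<epsilon> B(1) by (auto simp: \<delta>_def field_simps)
    obtain A V where AV: "openin (top_of_set {0..}) A" "openin E V" "0 \<in> A" "x \<in> V"
       "\<forall>s\<in>A. \<forall>y\<in>V. \<bar>kernel_op (P s) h y - kernel_op (P 0) h x\<bar> < \<delta>"
      using box[OF hc, of 0 \<delta>] \<delta> by auto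
    have "\<bar>kernel_op (P s) f y - kernel_op (P t) f x\<bar> < \<epsilon>" if sy: "s \<in> A" "y \<in> V" for s y
    proof -
      have "s \<ge> 0" "y \<in> topspace E"
        using sy openin_subset[OF AV(1)] openin_subset[OF AV(2)] by auto
      then have "\<bar>kernel_op (P s) f y - f x\<bar> \<le> \<epsilon> / 2 + 2 * B * kernel_op (P s) h y"
        by (rule est)
      moreover have "kernel_op (P s) h y \<le> \<delta>"
        using AV(5) sy P0f[OF hb] h(2) by fastforce
      then have "2 * B * kernel_op (P s) h y \<le> 2 * B * \<delta>"
        using B(1) by (simp add: mult_left_mono)
      ultimately show ?thesis
        using \<delta>(2) P0f[OF f] True by simp
    qed
    then show ?thesis
      using AV True by blast
  qed
qed

section \<open>Restriction to the complement of a polar set\<close>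

lemma restrict_kernel_at:
  assumes "sets (P t x) = sets (borel_of E)" and F: "F \<in> sets (borel_of E)"
  shows "sets (restrict_kernel P F t x) = sets (borel_of (subtopology E F))"
    and "kernel_op (restrict_kernel P F t) f x = kernel_op (P t) (\<lambda>y. indicator F y * f y) x"
    and "A \<in> sets (borel_of (subtopology E F)) \<Longrightarrow>
           emeasure (restrict_kernel P F t x) A = emeasure (P t x) A"
proof -
  have F': "F \<inter> space (P t x) \<in> sets (P t x)"
    using assms by (metis sets.Int sets.top)
  show "sets (restrict_kernel P F t x) = sets (borel_of (subtopology E F))"
    using assms by (simp add: restrict_kernel_def borel_of_subtopology sets_restrict_space)
  show "kernel_op (restrict_kernel P F t) f x = kernel_op (P t) (\<lambda>y. indicator F y * f y) x"
    using F' by (simp add: kernel_op_def restrict_kernel_def integral_restrict_space)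
  assume "A \<in> sets (borel_of (subtopology E F))"
  then have "A \<subseteq> F"
    using sets.sets_into_space by fastforce
  then show "emeasure (restrict_kernel P F t x) A = emeasure (P t x) A"
    using F' by (simp add: restrict_kernel_def emeasure_restrict_space)
qed

text \<open>
  The semigroup law survives the restriction because the intermediate position at time \<open>t\<close> lies in \<open>F\<close>
  almost surely; for \<open>t = 0\<close> this is the choice of the starting point.
\<close>

lemma markov_semigroup_restrict:
  assumes P: "markov_semigroup E P" and F: "F \<in> sets (borel_of E)"
    and null: "\<And>t x. t > 0 \<Longrightarrow> x \<in> F \<Longrightarrow> emeasure (P t x) (topspace E - F) = 0"
  shows "markov_semigroup (subtopology E F) (restrict_kernel P F)"
proof -
  let ?S = "subtopology E F" and ?Q = "restrict_kernel P F"
  have FE: "F \<subseteq> topspace E"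
    using sets.sets_into_space[OF F] by simp
  have mk: "markov_kernel E (P t)" if "t \<ge> 0" for t
    using P that by (simp add: markov_semigroup_def)
  have P0: "P 0 x = return (borel_of E) x" if "x \<in> topspace E" for x
    using P that by (simp add: markov_semigroup_def)
  have compl: "topspace E - F \<in> sets (borel_of E)"
    using sets.compl_sets[OF F] by simp
  have AE_F: "AE y in P t x. y \<in> F" if "t \<ge> 0" "x \<in> F" for t x
  proof -
    have x: "x \<in> topspace E" using that FE by auto
    note K = markov_kernel_at[OF mk[OF that(1)] x]
    have "emeasure (P t x) (topspace E - F) = 0"
      using null[of t x] P0[OF x] that compl by (cases "t = 0") auto
    then have "topspace E - F \<in> null_sets (P t x)"
      using K(2) compl by (simp add: null_sets_def)
    then show ?thesis
      using K(3) by (intro AE_I') auto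
  qed
  have Q_kernel: "markov_kernel ?S (?Q t)" if t: "t \<ge> 0" for t
    unfolding markov_kernel_def
  proof (rule measurable_prob_algebraI)
    fix x assume "x \<in> space (borel_of ?S)"
    then have x: "x \<in> F" "x \<in> topspace E" by auto
    note K = markov_kernel_at[OF mk[OF t] x(2)]
    interpret prob_space "P t x" by (rule K(1))
    have "emeasure (P t x) F = 1"
      using AE_F[OF t x(1)] F K(2) by (intro emeasure_eq_1_AE) auto
    moreover have "F \<in> sets (P t x)"
      using F K by simp
    ultimately show "prob_space (?Q t x)"
      by (intro prob_spaceI) (simp add: restrict_kernel_def emeasure_restrict_space sets.Int_space_eq2)
  next
    show "?Q t \<in> borel_of ?S \<rightarrow>\<^sub>M subprob_algebra (borel_of ?S)"
    \<comment> \<open>subprobability spaces are nonempty, so the empty \<open>F\<close> needs a separate (vacuous) argument\<close>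
    proof (cases "F = {}")
      case True
      then show ?thesis
        by (simp add: measurable_def)
    next
      case False
      have "P t \<in> borel_of E \<rightarrow>\<^sub>M subprob_algebra (borel_of E)"
        using mk[OF t] measurable_prob_algebraD by (auto simp: markov_kernel_def)
      then have "?Q t \<in> borel_of E \<rightarrow>\<^sub>M subprob_algebra (restrict_space (borel_of E) F)"
        using restrict_space_measurable[OF False F] by (simp add: restrict_kernel_def[abs_def])
      then have "?Q t \<in> restrict_space (borel_of E) F \<rightarrow>\<^sub>M subprob_algebra (borel_of ?S)"
        using subprob_algebra_cong[OF borel_of_subtopology[OF F]] measurable_restrict_space1 by metis
      then show ?thesis
        using measurable_cong_sets[OF borel_of_subtopology[OF F] refl] by blast
    qed
  qed
  moreover have "?Q 0 x = return (borel_of ?S) x" if "x \<in> topspace ?S" for x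
  proof -
    have "?Q 0 x = restrict_space (return (borel_of E) x) F"
      using that by (simp add: restrict_kernel_def P0)
    also have "\<dots> = return (restrict_space (borel_of E) F) x"
      using F by (simp add: return_restrict_space)
    also have "\<dots> = return (borel_of ?S) x"
      by (rule return_cong) (simp add: borel_of_subtopology[OF F])
    finally show ?thesis .
  qed
  moreover have "?Q (t + s) x = ?Q t x \<bind> ?Q s" if "t \<ge> 0" "s \<ge> 0" "x \<in> topspace ?S" for t s x
  proof (rule measure_eqI)
    have x: "x \<in> F" "x \<in> topspace E" using that by auto
    note Kts = markov_kernel_at[OF mk[of "t + s"] x(2)] and Kt = markov_kernel_at[OF mk[OF that(1)] x(2)]
    have Qt: "?Q t x \<in> space (prob_algebra (borel_of ?S))"
      using markov_kernel_at[OF Q_kernel[OF that(1)] that(3)] by (simp add: space_prob_algebra)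
    have Qs: "?Q s \<in> borel_of ?S \<rightarrow>\<^sub>M prob_algebra (borel_of ?S)"
      using Q_kernel[OF that(2)] by (simp add: markov_kernel_def)
    have sets_lhs: "sets (?Q (t + s) x) = sets (borel_of ?S)"
      using Kts that F by (intro restrict_kernel_at) auto
    then show "sets (?Q (t + s) x) = sets (?Q t x \<bind> ?Q s)"
      by (simp add: sets_bind'[OF Qt Qs])
    fix A assume "A \<in> sets (?Q (t + s) x)"
    then have A: "A \<in> sets (borel_of ?S)" "A \<in> sets (borel_of E)"
      using sets_lhs F borel_of_subtopology[OF F] sets_restrict_space_iff[of F "borel_of E" A] FE
      by (auto simp: Int_absorb2)
    have "emeasure (?Q (t + s) x) A = emeasure (P t x \<bind> P s) A"
      using restrict_kernel_at(3)[OF _ F A(1)] Kts that P x by (simp add: markov_semigroup_def)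
    also have "\<dots> = (\<integral>\<^sup>+ y. emeasure (P s y) A \<partial>P t x)"
      using Kt mk[OF that(2)] A
      by (intro emeasure_bind_prob_algebra[where N = "borel_of E" and L = "borel_of E"])
         (auto simp: space_prob_algebra markov_kernel_def)
    also have "\<dots> = (\<integral>\<^sup>+ y. emeasure (?Q s y) A * indicator F y \<partial>P t x)"
    proof (rule nn_integral_cong_AE)
      show "AE y in P t x. emeasure (P s y) A = emeasure (?Q s y) A * indicator F y"
        using AE_F[OF that(1) x(1)]
      proof (rule AE_mp, intro AE_I2 impI)
        fix y assume "y \<in> F"
        then show "emeasure (P s y) A = emeasure (?Q s y) A * indicator F y"
          using restrict_kernel_at(3)[OF _ F A(1)] markov_kernel_at(2)[OF mk[OF that(2)]] FE by auto
      qed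
    qed
    also have "\<dots> = (\<integral>\<^sup>+ y. emeasure (?Q s y) A \<partial>?Q t x)"
      using F FE Kt by (simp add: restrict_kernel_def nn_integral_restrict_space Int_absorb2)
    also have "\<dots> = emeasure (?Q t x \<bind> ?Q s) A"
      by (rule emeasure_bind_prob_algebra[OF Qt Qs A(1), symmetric])
    finally show "emeasure (?Q (t + s) x) A = emeasure (?Q t x \<bind> ?Q s) A" .
  qed
  ultimately show ?thesis
    by (simp add: markov_semigroup_def)
qed

lemma strong_feller_restrict:
  assumes K: "markov_kernel E (P t)" and F: "F \<in> sets (borel_of E)" and SF: "strong_feller E (P t)"
  shows "strong_feller (subtopology E F) (restrict_kernel P F t)"
  unfolding strong_feller_def
proof
  let ?S = "subtopology E F"
  fix f assume "f \<in> bounded_borel ?S"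
  then have "kernel_op (P t) (\<lambda>y. indicator F y * f y) \<in> bounded_continuous E"
    using SF bounded_borel_extend_by_zero[OF F] by (auto simp: strong_feller_def)
  then have "kernel_op (P t) (\<lambda>y. indicator F y * f y) \<in> bounded_continuous ?S"
    by (auto simp: bounded_continuous_def continuous_map_from_subtopology elim!: bounded_subset)
  moreover have "kernel_op (P t) (\<lambda>y. indicator F y * f y) x = kernel_op (restrict_kernel P F t) f x"
    if "x \<in> topspace ?S" for x
    using restrict_kernel_at(2)[OF _ F] markov_kernel_at(2)[OF K] that by simp
  ultimately show "kernel_op (restrict_kernel P F t) f \<in> bounded_continuous ?S"
    by (rule bounded_continuous_cong[THEN iffD1, rotated])
qed

text \<open>
  Openness of \<open>F\<close> is what makes the extension by zero continuous at the points of \<open>F\<close>, as needed at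
  time \<open>0\<close>.
\<close>

lemma jointly_continuous_restrict:
  assumes E: "metrizable_space E" and P: "markov_semigroup E P"
    and SF: "\<And>t. t > 0 \<Longrightarrow> strong_feller E (P t)"
    and JC: "jointly_continuous_semigroup E P" and F: "openin E F"
  shows "jointly_continuous_semigroup (subtopology E F) (restrict_kernel P F)"
  unfolding jointly_continuous_semigroup_def
proof
  let ?S = "subtopology E F" and ?Q = "restrict_kernel P F"
  have FB: "F \<in> sets (borel_of E)"
    by (rule borel_of_open[OF F])
  have top: "topspace ?S = F"
    using openin_subset[OF F] by auto
  fix f assume f: "f \<in> bounded_continuous ?S"
  define g where "g = (\<lambda>y. indicator F y * f y)"
  have g: "g \<in> bounded_borel E"
    using bounded_borel_extend_by_zero[OF FB] f bounded_continuous_subset_bounded_borel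
    unfolding g_def by blast
  have Qg: "kernel_op (?Q t) f x = kernel_op (P t) g x" if "t \<ge> 0" "x \<in> F" for t x
  proof -
    have "markov_kernel E (P t)" "x \<in> topspace E"
      using P that openin_subset[OF F] by (auto simp: markov_semigroup_def)
    then show ?thesis
      using restrict_kernel_at(2)[of P t x E F f] markov_kernel_at(2)[of E "P t" x] FB by (simp add: g_def)
  qed
  have g_cont: "\<exists>U. openin E U \<and> x \<in> U \<and> (\<forall>y\<in>U. \<bar>g y - g x\<bar> < \<epsilon>)" if x: "x \<in> F" and \<epsilon>: "\<epsilon> > 0" for x \<epsilon>
  proof -
    obtain U where U: "openin ?S U" "x \<in> U" "\<forall>y\<in>U. \<bar>f y - f x\<bar> < \<epsilon>"
      using f x \<epsilon> top unfolding bounded_continuous_def continuous_map_real_iff by blast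
    then have "openin E U" "U \<subseteq> F"
      using openin_open_subtopology[OF F] by auto
    then show ?thesis
      using U x by (intro exI[of _ U]) (auto simp: g_def indicator_def)
  qed
  show "continuous_map (prod_topology (top_of_set {0..}) ?S) euclideanreal (\<lambda>(t, x). kernel_op (?Q t) f x)"
    unfolding continuous_map_real_iff
  proof (intro ballI allI impI)
    fix z :: "real \<times> 'a" and \<epsilon> :: real assume "z \<in> topspace (prod_topology (top_of_set {0..}) ?S)" and \<epsilon>: "\<epsilon> > 0"
    then obtain t x where z: "z = (t, x)" and t: "t \<ge> 0" and x: "x \<in> F"
      using top by auto
    have "x \<in> topspace E" using x openin_subset[OF F] by auto
    then have "\<exists>A B. openin (top_of_set {0..}) A \<and> openin E B \<and> t \<in> A \<and> x \<in> B \<and>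
      (\<forall>s\<in>A. \<forall>y\<in>B. \<bar>kernel_op (P s) g y - kernel_op (P t) g x\<bar> < \<epsilon>)"
      using g_cont[OF x] by (intro strong_feller_joint_continuity[OF E P SF JC g _ t \<epsilon>])
    then obtain A B where AB: "openin (top_of_set {0..}) A" "openin E B" "t \<in> A" "x \<in> B"
      "\<forall>s\<in>A. \<forall>y\<in>B. \<bar>kernel_op (P s) g y - kernel_op (P t) g x\<bar> < \<epsilon>"
      by blast
    have "A \<subseteq> {0..}" using openin_subset[OF AB(1)] by simp
    then have "\<bar>kernel_op (?Q s) f y - kernel_op (?Q t) f x\<bar> < \<epsilon>" if "s \<in> A" "y \<in> F \<inter> B" for s y
      using that AB(5) Qg t x by auto
    moreover have "openin (prod_topology (top_of_set {0..}) ?S) (A \<times> (F \<inter> B))"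
      using AB(1,2) by (auto simp: openin_prod_Times_iff openin_subtopology_Int2)
    ultimately show "\<exists>U. openin (prod_topology (top_of_set {0..}) ?S) U \<and> z \<in> U \<and>
        (\<forall>w\<in>U. \<bar>(case w of (t, x) \<Rightarrow> kernel_op (?Q t) f x) - (case z of (t, x) \<Rightarrow> kernel_op (?Q t) f x)\<bar> < \<epsilon>)"
      using AB(3,4) x z by (intro exI[of _ "A \<times> (F \<inter> B)"]) auto
  qed
qed

section \<open>Paths that avoid a closed set\<close>

text \<open>
  The sets \<open>C k\<close> consist of the points at distance at least \<open>1 / (k + 1)\<close> from \<open>N\<close>.
\<close>

lemma closedin_metrizable_exhaustion:
  assumes E: "metrizable_space E" and N: "closedin E N"
  obtains C :: "nat \<Rightarrow> 'a set"
    where "incseq C" "\<And>k. closedin E (C k)" "\<And>k. C k \<inter> N = {}"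
      "\<And>x. x \<in> topspace E - N \<Longrightarrow> \<exists>U k. openin E U \<and> x \<in> U \<and> U \<subseteq> C k"
proof -
  obtain M d where "Metric_space M d" and E_eq: "E = Metric_space.mtopology M d"
    using E by (auto simp: metrizable_space_def)
  then interpret Metric_space M d by simp
  have top: "topspace E = M" by (simp add: E_eq)
  define V where "V k = (\<Union>a\<in>N. mball a (1 / real (Suc k)))" for k
  have V_open: "openin E (V k)" for k
    unfolding V_def E_eq by (intro openin_Union) auto
  define C where "C k = topspace E - V k" for k
  show thesis
  proof
    show "incseq C"
    proof (rule incseq_SucI)
      fix k
      have "1 / real (Suc (Suc k)) \<le> 1 / real (Suc k)"
        by (simp add: field_simps)
      then have "mball a (1 / real (Suc (Suc k))) \<subseteq> mball a (1 / real (Suc k))" for a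
        by (rule mball_subset_concentric)
      then show "C k \<subseteq> C (Suc k)"
        unfolding C_def V_def by blast
    qed
    show "closedin E (C k)" for k
      unfolding C_def using V_open by (intro closedin_diff closedin_topspace)
    have "N \<subseteq> V k" for k
    proof
      fix a assume "a \<in> N"
      moreover from this have "a \<in> M" using closedin_subset[OF N] top by auto
      ultimately show "a \<in> V k" by (auto simp: V_def)
    qed
    then show "C k \<inter> N = {}" for k
      by (auto simp: C_def)
    fix x assume "x \<in> topspace E - N"
    moreover have "openin mtopology (topspace E - N)"
      using N E_eq by (auto simp: closedin_def)
    ultimately obtain r where r: "r > 0" "mball x r \<subseteq> topspace E - N" and x: "x \<in> M"
      unfolding openin_mtopology top by blast
    obtain k where k: "1 / real (Suc k) < r / 2"
      using r(1) reals_Archimedean[of "r / 2"] by (auto simp: inverse_eq_divide)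
    have "mball x (r / 2) \<inter> V k = {}"
    proof (rule ccontr)
      assume "mball x (r / 2) \<inter> V k \<noteq> {}"
      then obtain a y where ay: "a \<in> N" "y \<in> mball a (1 / real (Suc k))" "y \<in> mball x (r / 2)"
        unfolding V_def by blast
      then have m: "a \<in> M" "y \<in> M" "d a y < 1 / real (Suc k)" "d x y < r / 2"
        by (auto simp: in_mball)
      then have "d x a < r"
        using triangle[of x y a] x k by (simp add: commute)
      then have "a \<in> mball x r" using m x by (simp add: in_mball)
      then show False using ay(1) r(2) by auto
    qed
    then have "mball x (r / 2) \<subseteq> C k"
      using top mball_subset_mspace by (auto simp: C_def)
    moreover have "openin E (mball x (r / 2))" "x \<in> mball x (r / 2)"
      using x r(1) by (auto simp: E_eq)
    ultimately show "\<exists>U k. openin E U \<and> x \<in> U \<and> U \<subseteq> C k" by blast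
  qed
qed

text \<open>
  Near each time \<open>t\<close> the path stays in some \<open>C k\<close>: to the right because of right continuity, to the
  left because the left limit exists \<^emph>\<open>in\<close> \<open>S\<close> and hence has a neighbourhood contained in some \<open>C k\<close>.
  Compactness of the time interval, in the form of Bolzano's bisection principle, makes \<open>k\<close> uniform.
\<close>

lemma cadlag_range_in_exhaustion:
  assumes y: "cadlag S y" and C: "incseq C"
    and ex: "\<And>x. x \<in> topspace S \<Longrightarrow> \<exists>U k. openin S U \<and> x \<in> U \<and> U \<subseteq> C k"
  shows "\<exists>k. \<forall>s\<in>{0..T}. y s \<in> C k"
proof (cases "0 \<le> T")
  case True
  \<comment> \<open>the restriction to \<open>s \<ge> 0\<close> matters: bisection also considers intervals that start before \<open>0\<close>\<close>
  define R where "R a b \<longleftrightarrow> (\<exists>k. \<forall>s\<in>{a..b}. s \<ge> 0 \<longrightarrow> y s \<in> C k)" for a b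
  have event: "\<exists>k. eventually (\<lambda>s. y s \<in> C k) G" if L: "limitin S y l G" for l G
  proof -
    obtain U k where "openin S U" "l \<in> U" "U \<subseteq> C k"
      using ex L by (meson limitin_def)
    then have "eventually (\<lambda>s. y s \<in> C k) G"
      using L unfolding limitin_def by (blast intro: eventually_mono)
    then show ?thesis ..
  qed
  have mono: "z \<in> C k \<Longrightarrow> k \<le> j \<Longrightarrow> z \<in> C j" for z j k
    using C by (auto dest: monoD)
  have "R 0 T"
    using True
  proof (induction rule: Bolzano)
    case (trans a b c)
    then obtain j k where "\<forall>s\<in>{a..b}. s \<ge> 0 \<longrightarrow> y s \<in> C j" "\<forall>s\<in>{b..c}. s \<ge> 0 \<longrightarrow> y s \<in> C k"
      by (auto simp: R_def)
    then have "\<forall>s\<in>{a..c}. s \<ge> 0 \<longrightarrow> y s \<in> C (max j k)"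
      by (metis atLeastAtMost_iff linear max.cobounded1 max.cobounded2 mono)
    then show ?case by (auto simp: R_def)
  next
    case (local x)
    have right: "limitin S y (y x) (at_right x)"
      using y local by (simp add: cadlag_def)
    then obtain U i where "openin S U" "y x \<in> U" "U \<subseteq> C i"
      using ex by (meson limitin_def)
    then have i: "y x \<in> C i" by auto
    obtain j where "eventually (\<lambda>s. y s \<in> C j) (at_right x)"
      using event right by blast
    then obtain b where b: "b > x" "\<And>s. x < s \<Longrightarrow> s < b \<Longrightarrow> y s \<in> C j"
      unfolding eventually_at_right[OF less_add_one] by blast
    have "\<exists>a k. a < x \<and> (\<forall>s. a < s \<longrightarrow> s < x \<longrightarrow> s \<ge> 0 \<longrightarrow> y s \<in> C k)"
    proof (cases "x = 0")
      case True
      then show ?thesis by (intro exI[of _ "-1"]) auto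
    next
      case False
      then have "x > 0"
        using local by simp
      then obtain l where "limitin S y l (at_left x)"
        using y unfolding cadlag_def by blast
      then obtain k where "eventually (\<lambda>s. y s \<in> C k) (at_left x)"
        using event by blast
      moreover have "x - 1 < x"
        by simp
      ultimately show ?thesis
        unfolding eventually_at_left[OF \<open>x - 1 < x\<close>] by blast
    qed
    then obtain a k where a: "a < x" "\<And>s. a < s \<Longrightarrow> s < x \<Longrightarrow> s \<ge> 0 \<Longrightarrow> y s \<in> C k"
      by blast
    have "y s \<in> C (max i (max j k))" if "a < s" "s < b" "s \<ge> 0" for s
      using that a(2)[of s] b(2)[of s] i mono
      by (cases s x rule: linorder_cases) (auto simp: le_max_iff_disj)
    then have "R a' b'" if "a' \<le> x" "x \<le> b'" "b' - a' < min (x - a) (b - x)" for a' b'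
      using that unfolding R_def by (intro exI[of _ "max i (max j k)"]) auto
    then show ?case
      using a(1) b(1) by (intro exI[of _ "min (x - a) (b - x)"]) auto
  qed
  then show ?thesis by (auto simp: R_def)
qed auto

definition dyadic_times :: "nat \<Rightarrow> real set" where
  "dyadic_times T = {real i / 2 ^ n |i n. i \<le> T * 2 ^ n}"

lemma dyadic_times_dense:
  fixes a b :: real
  assumes a: "0 \<le> a" "a < b" "a < real T"
  obtains s where "s \<in> dyadic_times T" "a < s" "s < b"
proof -
  define c where "c = min b (real T)"
  obtain n where "(1 / 2 :: real) ^ n < c - a"
    using real_arch_pow_inv[of "c - a" "1 / 2"] a by (auto simp: c_def)
  then have n: "1 / 2 ^ n < c - a"
    by (simp add: power_one_over)
  define i where "i = nat (\<lfloor>a * 2 ^ n\<rfloor> + 1)"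
  have "0 \<le> \<lfloor>a * 2 ^ n\<rfloor>"
    using a(1) by simp
  then have i: "a * 2 ^ n < real i" "real i \<le> a * 2 ^ n + 1"
    unfolding i_def by linarith+
  have "a < real i / 2 ^ n"
    using i(1) by (simp add: field_simps)
  moreover have "real i / 2 ^ n \<le> a + 1 / 2 ^ n"
    using i(2) by (simp add: field_simps)
  then have c: "real i / 2 ^ n < c"
    using n by linarith
  then have "real i / 2 ^ n < real T"
    by (simp add: c_def)
  then have "real i < real (T * 2 ^ n)"
    by (simp add: field_simps)
  then have "i \<le> T * 2 ^ n"
    by linarith
  then have "real i / 2 ^ n \<in> dyadic_times T"
    by (auto simp: dyadic_times_def)
  ultimately show thesis
    using c that by (simp add: c_def)
qed

text \<open>
  If the path visits \<open>N\<close> at time \<open>t\<close>, it is in the open complement of \<open>C k\<close> right after \<open>t\<close>, and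
  hence at some dyadic time.
\<close>

lemma cadlag_avoids_if_dyadic_values_avoid:
  assumes x: "cadlag E x" and C: "incseq C" "\<And>k. closedin E (C k)" "\<And>k. C k \<inter> N = {}"
    and stay: "\<And>T. \<exists>k. \<forall>s\<in>dyadic_times T. x s \<in> C k" and t: "t \<ge> 0"
  shows "x t \<notin> N"
proof
  assume N: "x t \<in> N"
  obtain T :: nat where T: "t < real T"
    using reals_Archimedean2 by blast
  obtain k where k: "\<forall>s\<in>dyadic_times T. x s \<in> C k"
    using stay by blast
  have lim: "limitin E x (x t) (at_right t)"
    using x t by (simp add: cadlag_def)
  then have "x t \<in> topspace E - C k"
    using C(3)[of k] N by (auto simp: limitin_def)
  moreover have "openin E (topspace E - C k)"
    using C(2) by (simp add: openin_diff)
  ultimately have "eventually (\<lambda>s. x s \<in> topspace E - C k) (at_right t)"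
    using lim by (auto simp: limitin_def)
  then obtain b where b: "b > t" "\<And>s. t < s \<Longrightarrow> s < b \<Longrightarrow> x s \<notin> C k"
    unfolding eventually_at_right[OF less_add_one] by blast
  obtain s where "s \<in> dyadic_times T" "t < s" "s < b"
    using dyadic_times_dense[OF t b(1) T] .
  then show False using b k by blast
qed

section \<open>Finite-dimensional distributions\<close>

text \<open>
  The probability that the Markov chain with transition kernel \<open>K\<close>, started at a given point, is in \<open>C\<close>
  at each of the steps \<open>0, \<dots>, m\<close>. The start counts too, so the function vanishes off \<open>C\<close>; this lets
  one compare kernels on \<open>E\<close> and on a subspace containing \<open>C\<close>.
\<close>

primrec stay_prob :: "('a \<Rightarrow> 'a measure) \<Rightarrow> 'a set \<Rightarrow> nat \<Rightarrow> 'a \<Rightarrow> real" where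
  "stay_prob K C 0 = indicator C"
| "stay_prob K C (Suc m) = (\<lambda>x. indicator C x * kernel_op K (stay_prob K C m) x)"

lemma stay_prob_bounded_borel:
  assumes "markov_kernel X K" "C \<in> sets (borel_of X)"
  shows "stay_prob K C m \<in> bounded_borel X"
proof (induction m)
  case 0
  show ?case
    using indicator_bounded_borel[OF assms(2)] by simp
next
  case (Suc m)
  then have "kernel_op K (stay_prob K C m) \<in> bounded_borel X"
    by (rule kernel_op_bounded_borel[OF assms(1)])
  then show ?case
    using bounded_borel_times[OF indicator_bounded_borel[OF assms(2)]] by simp
qed

lemma stay_prob_eq_0: "x \<notin> C \<Longrightarrow> stay_prob K C m x = 0"
  by (cases m) auto

lemma stay_prob_restrict:
  assumes P: "markov_kernel E (P t)" and F: "F \<in> sets (borel_of E)" and C: "C \<subseteq> F"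
  shows "stay_prob (restrict_kernel P F t) C m = stay_prob (P t) C m"
proof (induction m)
  case (Suc m)
  have "F \<subseteq> topspace E"
    using sets.sets_into_space[OF F] by simp
  then have "kernel_op (restrict_kernel P F t) (stay_prob (P t) C m) x = kernel_op (P t) (stay_prob (P t) C m) x"
    if "x \<in> C" for x
  proof -
    have "(\<lambda>y. indicator F y * stay_prob (P t) C m y) = stay_prob (P t) C m"
    proof
      fix y
      show "indicator F y * stay_prob (P t) C m y = stay_prob (P t) C m y"
        using stay_prob_eq_0[of y C] C by (cases "y \<in> C") auto
    qed
    then show ?thesis
      using restrict_kernel_at(2)[of P t x E F] markov_kernel_at(2)[OF P, of x] F that C \<open>F \<subseteq> topspace E\<close>
      by auto
  qed
  then show ?case
    by (auto simp: Suc indicator_def)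
qed simp

lemma markov_process_at:
  assumes X: "markov_process S P \<mu> M \<F> X" and t: "t \<ge> 0"
  shows "prob_space M" "subalgebra M (\<F> t)" "X t \<in> \<F> t \<rightarrow>\<^sub>M borel_of S" "X t \<in> M \<rightarrow>\<^sub>M borel_of S"
proof -
  show "prob_space M" and sub: "subalgebra M (\<F> t)" and meas: "X t \<in> \<F> t \<rightarrow>\<^sub>M borel_of S"
    using X t by (auto simp: markov_process_def filtered_prob_space_def)
  show "X t \<in> M \<rightarrow>\<^sub>M borel_of S"
    by (rule measurable_from_subalg[OF sub meas])
qed

text \<open>
  The conditional form of the Markov property, integrated against what is known at time \<open>t\<close>.
\<close>

lemma markov_property_integral:
  fixes X :: "real \<Rightarrow> 'w \<Rightarrow> 'a" and Z :: "'w \<Rightarrow> real"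
  assumes P: "markov_semigroup S P" and X: "markov_process S P \<mu> M \<F> X"
    and t: "t \<ge> 0" and s: "s \<ge> 0" and f: "f \<in> bounded_borel S"
    and Z: "Z \<in> borel_measurable (\<F> t)" "\<And>\<omega>. \<omega> \<in> space M \<Longrightarrow> \<bar>Z \<omega>\<bar> \<le> 1"
  shows "(\<integral>\<omega>. Z \<omega> * f (X (t + s) \<omega>) \<partial>M) = (\<integral>\<omega>. Z \<omega> * kernel_op (P s) f (X t \<omega>) \<partial>M)"
proof -
  note Xt = markov_process_at[OF X t]
  have "t + s \<ge> 0" using s t by simp
  note Xts = markov_process_at[OF X this]
  interpret prob_space M by (rule Xt(1))
  interpret finite_measure_subalgebra M "\<F> t"
    by unfold_locales (rule Xt(2))
  have ZM [measurable]: "Z \<in> borel_measurable M"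
    by (rule measurable_from_subalg[OF Xt(2) Z(1)])
  have f_borel: "f \<in> borel_measurable (borel_of S)"
    using f by (simp add: bounded_borel_def)
  have fX [measurable]: "(\<lambda>\<omega>. f (X (t + s) \<omega>)) \<in> borel_measurable M"
    by (rule measurable_compose[OF Xts(4) f_borel])
  have "markov_kernel S (P s)"
    using P s by (simp add: markov_semigroup_def)
  then have "kernel_op (P s) f \<in> borel_measurable (borel_of S)"
    using kernel_op_bounded_borel[OF _ f] by (simp add: bounded_borel_def)
  then have kX [measurable]: "(\<lambda>\<omega>. kernel_op (P s) f (X t \<omega>)) \<in> borel_measurable M"
    using measurable_compose[OF Xt(4)] by blast
  obtain B where B: "B \<ge> 0" "\<And>x. x \<in> topspace S \<Longrightarrow> \<bar>f x\<bar> \<le> B"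
    using bounded_borel_bound[OF f] by metis
  have "\<bar>Z \<omega> * f (X (t + s) \<omega>)\<bar> \<le> 1 * B" if "\<omega> \<in> space M" for \<omega>
    using that Z(2) B measurable_space[OF Xts(4)] unfolding abs_mult by (intro mult_mono) auto
  then have "integrable M (\<lambda>\<omega>. Z \<omega> * f (X (t + s) \<omega>))"
    by (intro integrable_const_bound[of _ B]) (auto intro!: AE_I2)
  then have "(\<integral>\<omega>. Z \<omega> * f (X (t + s) \<omega>) \<partial>M) =
      (\<integral>\<omega>. Z \<omega> * real_cond_exp M (\<F> t) (\<lambda>\<omega>. f (X (t + s) \<omega>)) \<omega> \<partial>M)"
    using Z(1) by (intro real_cond_exp_intg(2)[symmetric]) auto
  also have "\<dots> = (\<integral>\<omega>. Z \<omega> * kernel_op (P s) f (X t \<omega>) \<partial>M)"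
  proof (rule integral_cong_AE)
    have "AE \<omega> in M. real_cond_exp M (\<F> t) (\<lambda>\<omega>. f (X (t + s) \<omega>)) \<omega> = kernel_op (P s) f (X t \<omega>)"
      using X s t f by (simp add: markov_process_def)
    then show "AE \<omega> in M. Z \<omega> * real_cond_exp M (\<F> t) (\<lambda>\<omega>. f (X (t + s) \<omega>)) \<omega>
        = Z \<omega> * kernel_op (P s) f (X t \<omega>)"
      by (rule AE_mp) (auto intro!: AE_I2)
  qed measurable
  finally show ?thesis .
qed

text \<open>
  The weight \<open>Z\<close> makes the induction on \<open>m\<close> possible: the first factor is measurable at time \<open>t\<close> and is
  absorbed in the weight, the remaining factors form a product of the same shape that starts at time
  \<open>t + h\<close>.
\<close>

lemma markov_process_stay_integral:
  fixes X :: "real \<Rightarrow> 'w \<Rightarrow> 'a" and Z :: "'w \<Rightarrow> real"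
  assumes P: "markov_semigroup S P" and X: "markov_process S P \<mu> M \<F> X"
    and h: "h \<ge> 0" and C: "C \<in> sets (borel_of S)" and t: "t \<ge> 0"
    and Z: "Z \<in> borel_measurable (\<F> t)" "\<And>\<omega>. \<omega> \<in> space M \<Longrightarrow> \<bar>Z \<omega>\<bar> \<le> 1"
  shows "(\<integral>\<omega>. Z \<omega> * (\<Prod>i\<le>m. indicator C (X (t + real i * h) \<omega>)) \<partial>M)
       = (\<integral>\<omega>. Z \<omega> * stay_prob (P h) C m (X t \<omega>) \<partial>M)"
  using t Z
proof (induction m arbitrary: t Z)
  case (Suc m)
  have mk: "markov_kernel S (P h)"
    using P h by (simp add: markov_semigroup_def)
  define Z' where "Z' = (\<lambda>\<omega>. Z \<omega> * indicator C (X t \<omega>))"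
  have "(\<lambda>\<omega>. indicator C (X t \<omega>) :: real) \<in> borel_measurable (\<F> t)"
    using measurable_compose[OF markov_process_at(3)[OF X \<open>t \<ge> 0\<close>] borel_measurable_indicator[OF C]] .
  then have Z'_t: "Z' \<in> borel_measurable (\<F> t)"
    unfolding Z'_def using Suc.prems(2) by (rule borel_measurable_times[rotated])
  have "subalgebra (\<F> (t + h)) (\<F> t)"
    using X h \<open>t \<ge> 0\<close> unfolding subalgebra_def markov_process_def filtered_prob_space_def by auto
  then have Z'_th: "Z' \<in> borel_measurable (\<F> (t + h))"
    using measurable_from_subalg Z'_t by blast
  have Z'_bound: "\<bar>Z' \<omega>\<bar> \<le> 1" if "\<omega> \<in> space M" for \<omega>
    using Suc.prems(3)[OF that] by (auto simp: Z'_def indicator_def)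
  have "(\<integral>\<omega>. Z \<omega> * (\<Prod>i\<le>Suc m. indicator C (X (t + real i * h) \<omega>)) \<partial>M)
      = (\<integral>\<omega>. Z' \<omega> * (\<Prod>i\<le>m. indicator C (X (t + h + real i * h) \<omega>)) \<partial>M)"
    unfolding prod.atMost_Suc_shift by (simp add: Z'_def algebra_simps)
  also have "\<dots> = (\<integral>\<omega>. Z' \<omega> * stay_prob (P h) C m (X (t + h) \<omega>) \<partial>M)"
    using Suc.IH[OF _ Z'_th Z'_bound] h \<open>t \<ge> 0\<close> by simp
  also have "\<dots> = (\<integral>\<omega>. Z' \<omega> * kernel_op (P h) (stay_prob (P h) C m) (X t \<omega>) \<partial>M)"
    by (rule markov_property_integral[OF P X \<open>t \<ge> 0\<close> h stay_prob_bounded_borel[OF mk C] Z'_t Z'_bound])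
  finally show ?case
    by (simp add: Z'_def mult.assoc)
qed simp

lemma markov_process_stay_prob:
  fixes X :: "real \<Rightarrow> 'w \<Rightarrow> 'a"
  assumes P: "markov_semigroup S P" and X: "markov_process S P \<mu> M \<F> X"
    and h: "h \<ge> 0" and C: "C \<in> sets (borel_of S)"
  shows "{\<omega> \<in> space M. \<forall>i\<le>m. X (real i * h) \<omega> \<in> C} \<in> sets M"
    and "measure M {\<omega> \<in> space M. \<forall>i\<le>m. X (real i * h) \<omega> \<in> C} = (\<integral>x. stay_prob (P h) C m x \<partial>\<mu>)"
proof -
  interpret prob_space M by (rule markov_process_at(1)[OF X order_refl])
  let ?A = "{\<omega> \<in> space M. \<forall>i\<le>m. X (real i * h) \<omega> \<in> C}"
  have [measurable]: "X (real i * h) \<in> M \<rightarrow>\<^sub>M borel_of S" for i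
    using h by (intro markov_process_at(4)[OF X]) simp
  have [measurable]: "C \<in> sets (borel_of S)" by (rule C)
  show A: "?A \<in> sets M"
    by measurable
  have mk: "markov_kernel S (P h)"
    using P h by (simp add: markov_semigroup_def)
  have "measure M ?A = (\<integral>\<omega>. indicator ?A \<omega> \<partial>M)"
    using A by simp
  also have "\<dots> = (\<integral>\<omega>. 1 * (\<Prod>i\<le>m. indicator C (X (0 + real i * h) \<omega>)) \<partial>M)"
  proof (rule Bochner_Integration.integral_cong)
    fix \<omega> assume "\<omega> \<in> space M"
    then show "indicator ?A \<omega> = 1 * (\<Prod>i\<le>m. indicator C (X (0 + real i * h) \<omega>) :: real)"
      by (cases "\<omega> \<in> ?A") (auto simp: prod_zero_iff indicator_def intro!: prod.neutral)
  qed simp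
  also have "\<dots> = (\<integral>\<omega>. stay_prob (P h) C m (X 0 \<omega>) \<partial>M)"
    using markov_process_stay_integral[OF P X h C order_refl, of "\<lambda>_. 1" m] by simp
  also have "\<dots> = (\<integral>x. stay_prob (P h) C m x \<partial>distr M (borel_of S) (X 0))"
    using stay_prob_bounded_borel[OF mk C] markov_process_at(4)[OF X order_refl]
    by (intro integral_distr[symmetric]) (auto simp: bounded_borel_def)
  also have "distr M (borel_of S) (X 0) = \<mu>"
    using X by (simp add: markov_process_def)
  finally show "measure M ?A = (\<integral>x. stay_prob (P h) C m x \<partial>\<mu>)" .
qed

text \<open>
  The left-hand side depends on \<open>P\<close> and \<open>\<mu>\<close> alone: the law of the process at dyadic times is determined by
  its transition function and its initial distribution. The dyadic grids are nested, so the
  events decrease with \<open>n\<close> and their probabilities converge.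
\<close>

lemma dyadic_stay_prob_LIMSEQ:
  fixes X :: "real \<Rightarrow> 'w \<Rightarrow> 'a"
  assumes P: "markov_semigroup S P" and X: "markov_process S P \<mu> M \<F> X"
    and C: "C \<in> sets (borel_of S)"
  shows "{\<omega> \<in> space M. \<forall>s\<in>dyadic_times T. X s \<omega> \<in> C} \<in> sets M"
    and "(\<lambda>n. \<integral>x. stay_prob (P (1 / 2 ^ n)) C (T * 2 ^ n) x \<partial>\<mu>)
           \<longlonglongrightarrow> measure M {\<omega> \<in> space M. \<forall>s\<in>dyadic_times T. X s \<omega> \<in> C}"
proof -
  interpret prob_space M by (rule markov_process_at(1)[OF X order_refl])
  define A where "A n = {\<omega> \<in> space M. \<forall>i\<le>T * 2 ^ n. X (real i * (1 / 2 ^ n)) \<omega> \<in> C}" for n :: nat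
  have A: "A n \<in> sets M" "measure M (A n) = (\<integral>x. stay_prob (P (1 / 2 ^ n)) C (T * 2 ^ n) x \<partial>\<mu>)" for n
    unfolding A_def by (rule markov_process_stay_prob[OF P X _ C]; simp)+
  have "A (Suc n) \<subseteq> A n" for n
  proof
    fix \<omega> assume \<omega>: "\<omega> \<in> A (Suc n)"
    have "X (real i * (1 / 2 ^ n)) \<omega> \<in> C" if "i \<le> T * 2 ^ n" for i
    proof -
      have "2 * i \<le> T * 2 ^ Suc n" using that by simp
      then have "X (real (2 * i) * (1 / 2 ^ Suc n)) \<omega> \<in> C"
        using \<omega> unfolding A_def by blast
      then show ?thesis by simp
    qed
    then show "\<omega> \<in> A n" using \<omega> by (simp add: A_def)
  qed
  then have "decseq A" by (rule decseq_SucI)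
  moreover have Int: "(\<Inter>n. A n) = {\<omega> \<in> space M. \<forall>s\<in>dyadic_times T. X s \<omega> \<in> C}"
    by (auto simp: A_def dyadic_times_def)
  ultimately show "(\<lambda>n. \<integral>x. stay_prob (P (1 / 2 ^ n)) C (T * 2 ^ n) x \<partial>\<mu>)
           \<longlonglongrightarrow> measure M {\<omega> \<in> space M. \<forall>s\<in>dyadic_times T. X s \<omega> \<in> C}"
    using finite_Lim_measure_decseq[of A] A by auto
  show "{\<omega> \<in> space M. \<forall>s\<in>dyadic_times T. X s \<omega> \<in> C} \<in> sets M"
    unfolding Int[symmetric] using A by (intro sets.countable_INT) auto
qed

section \<open>Comparison with a process on the complement\<close>

text \<open>
  As long as a chain is in \<open>C \<subseteq> F\<close> there is no difference between the transitions on \<open>E\<close> and on \<open>F\<close>,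
  so both probabilities are limits of the same sequence.
\<close>

lemma dyadic_stay_measure_eq:
  fixes X :: "real \<Rightarrow> 'w \<Rightarrow> 'a" and Y :: "real \<Rightarrow> 'v \<Rightarrow> 'a"
  assumes P: "markov_semigroup E P" and X: "markov_process E P \<mu> M \<F> X"
    and Q: "markov_semigroup (subtopology E F) (restrict_kernel P F)"
    and Y: "markov_process (subtopology E F) (restrict_kernel P F) (restrict_space \<mu> F) M' \<F>' Y"
    and F: "F \<in> sets (borel_of E)" and \<mu>: "sets \<mu> = sets (borel_of E)"
    and C: "C \<in> sets (borel_of E)" "C \<subseteq> F"
  shows "{\<omega> \<in> space M'. \<forall>s\<in>dyadic_times T. Y s \<omega> \<in> C} \<in> sets M'"
    and "measure M {\<omega> \<in> space M. \<forall>s\<in>dyadic_times T. X s \<omega> \<in> C}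
       = measure M' {\<omega> \<in> space M'. \<forall>s\<in>dyadic_times T. Y s \<omega> \<in> C}"
proof -
  have FE: "F \<subseteq> topspace E"
    using sets.sets_into_space[OF F] by simp
  have C': "C \<in> sets (borel_of (subtopology E F))"
    using C F FE borel_of_subtopology[OF F] sets_restrict_space_iff[of F "borel_of E" C]
    by (auto simp: Int_absorb2)
  have eq: "(\<integral>x. stay_prob (restrict_kernel P F t) C m x \<partial>restrict_space \<mu> F) = (\<integral>x. stay_prob (P t) C m x \<partial>\<mu>)"
    if t: "t \<ge> 0" for t m
  proof -
    have "(\<lambda>x. indicator F x *\<^sub>R stay_prob (P t) C m x) = stay_prob (P t) C m"
    proof
      fix x
      show "indicator F x *\<^sub>R stay_prob (P t) C m x = stay_prob (P t) C m x"
        using stay_prob_eq_0[of x C] C by (cases "x \<in> C") auto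
    qed
    moreover have "F \<inter> space \<mu> \<in> sets \<mu>"
      using F \<mu> by (metis sets.Int sets.top)
    moreover have "markov_kernel E (P t)"
      using P t by (simp add: markov_semigroup_def)
    ultimately show ?thesis
      using stay_prob_restrict[of E P t F C m] F C by (simp add: integral_restrict_space)
  qed
  show "{\<omega> \<in> space M'. \<forall>s\<in>dyadic_times T. Y s \<omega> \<in> C} \<in> sets M'"
    by (rule dyadic_stay_prob_LIMSEQ(1)[OF Q Y C'])
  show "measure M {\<omega> \<in> space M. \<forall>s\<in>dyadic_times T. X s \<omega> \<in> C}
       = measure M' {\<omega> \<in> space M'. \<forall>s\<in>dyadic_times T. Y s \<omega> \<in> C}"
    using dyadic_stay_prob_LIMSEQ(2)[OF Q Y C', of T]
    by (intro LIMSEQ_unique[OF dyadic_stay_prob_LIMSEQ(2)[OF P X C(1), of T]]) (simp add: eq)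
qed

text \<open>
  The path property that \<open>Y\<close> has as a cadlag process in \<open>F\<close>, transferred to \<open>X\<close>. For fixed \<open>T\<close> both
  probabilities of staying in \<open>C k\<close> agree, and for \<open>Y\<close> they increase to \<open>1\<close>.
\<close>

lemma AE_dyadic_values_in_exhaustion:
  fixes X :: "real \<Rightarrow> 'w \<Rightarrow> 'a" and Y :: "real \<Rightarrow> 'v \<Rightarrow> 'a"
  assumes P: "markov_semigroup E P" and X: "markov_process E P \<mu> M \<F> X"
    and Q: "markov_semigroup (subtopology E F) (restrict_kernel P F)"
    and Y: "markov_process (subtopology E F) (restrict_kernel P F) (restrict_space \<mu> F) M' \<F>' Y"
    and Y_cadlag: "AE \<omega> in M'. cadlag (subtopology E F) (\<lambda>t. Y t \<omega>)"
    and F: "openin E F" and \<mu>: "sets \<mu> = sets (borel_of E)"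
    and C: "incseq C" "\<And>k. closedin E (C k)" "\<And>k. C k \<subseteq> F"
    and ex: "\<And>x. x \<in> F \<Longrightarrow> \<exists>U k. openin E U \<and> x \<in> U \<and> U \<subseteq> C k"
  shows "AE \<omega> in M. \<forall>T. \<exists>k. \<forall>s\<in>dyadic_times T. X s \<omega> \<in> C k"
  unfolding AE_all_countable
proof
  fix T
  interpret M: prob_space M by (rule markov_process_at(1)[OF X order_refl])
  interpret M': prob_space M' by (rule markov_process_at(1)[OF Y order_refl])
  have FB: "F \<in> sets (borel_of E)" by (rule borel_of_open[OF F])
  have CB: "C k \<in> sets (borel_of E)" for k by (rule borel_of_closed[OF C(2)])
  define A where "A k = {\<omega> \<in> space M. \<forall>s\<in>dyadic_times T. X s \<omega> \<in> C k}" for k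
  define A' where "A' k = {\<omega> \<in> space M'. \<forall>s\<in>dyadic_times T. Y s \<omega> \<in> C k}" for k
  have A: "A k \<in> sets M" for k
    unfolding A_def by (rule dyadic_stay_prob_LIMSEQ(1)[OF P X CB])
  have A': "A' k \<in> sets M'" and eq: "measure M (A k) = measure M' (A' k)" for k
    unfolding A_def A'_def by (rule dyadic_stay_measure_eq[OF P X Q Y FB \<mu> CB C(3)])+
  have mono: "C j \<subseteq> C k" if "j \<le> k" for j k
    using C(1) that by (rule monoD)
  have inc: "incseq A" "incseq A'"
    using mono unfolding A_def A'_def by (intro monoI; blast)+
  have "AE \<omega> in M'. \<omega> \<in> (\<Union>k. A' k)"
    using Y_cadlag
  proof (rule AE_mp, intro AE_I2 impI)
    fix \<omega> assume \<omega>: "\<omega> \<in> space M'" "cadlag (subtopology E F) (\<lambda>t. Y t \<omega>)"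
    have "\<exists>k. \<forall>s\<in>{0..real T}. Y s \<omega> \<in> C k"
    proof (rule cadlag_range_in_exhaustion[OF \<omega>(2) C(1)])
      fix x assume "x \<in> topspace (subtopology E F)"
      then have "x \<in> F"
        by simp
      then obtain U k where "openin E U" "x \<in> U" "U \<subseteq> C k"
        using ex by blast
      moreover from this have "openin (subtopology E F) U"
        using C(3)[of k] by (simp add: openin_open_subtopology[OF F] order_trans)
      ultimately show "\<exists>U k. openin (subtopology E F) U \<and> x \<in> U \<and> U \<subseteq> C k"
        by metis
    qed
    moreover have "dyadic_times T \<subseteq> {0..real T}"
    proof
      fix s assume "s \<in> dyadic_times T"
      then obtain i n where s: "s = real i / 2 ^ n" and "i \<le> T * 2 ^ n"
        by (auto simp: dyadic_times_def)
      then have "real i \<le> real (T * 2 ^ n)" by (simp only: of_nat_le_iff)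
      then show "s \<in> {0..real T}" by (simp add: s field_simps)
    qed
    ultimately show "\<omega> \<in> (\<Union>k. A' k)"
      using \<omega>(1) by (fastforce simp: A'_def)
  qed
  then have "measure M' (\<Union>k. A' k) = 1"
    using A' by (intro M'.prob_eq_1[THEN iffD2]) auto
  moreover have "(\<lambda>k. measure M' (A' k)) \<longlonglongrightarrow> measure M' (\<Union>k. A' k)"
    using A' inc by (intro M'.finite_Lim_measure_incseq) auto
  moreover have "(\<lambda>k. measure M (A k)) \<longlonglongrightarrow> measure M (\<Union>k. A k)"
    using A inc by (intro M.finite_Lim_measure_incseq) auto
  ultimately have "measure M (\<Union>k. A k) = 1"
    using LIMSEQ_unique eq by auto
  then have "AE \<omega> in M. \<omega> \<in> (\<Union>k. A k)"
    by (rule M.AE_prob_1)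
  then show "AE \<omega> in M. \<exists>k. \<forall>s\<in>dyadic_times T. X s \<omega> \<in> C k"
    by (rule AE_mp) (auto intro!: AE_I2 simp: A_def)
qed

theorem theorem2p1:
  fixes E :: "'a topology"
    and P :: "real \<Rightarrow> 'a \<Rightarrow> 'a measure"
    and \<mu> :: "'a measure"
    and M :: "'w measure"
    and \<F> :: "real \<Rightarrow> 'w measure"
    and X :: "real \<Rightarrow> 'w \<Rightarrow> 'a"
    and N :: "'a set"
  assumes "Polish_space E"
    and "markov_semigroup E P"
    and "prob_space \<mu>" and "sets \<mu> = sets (borel_of E)"
    and "\<And>t. t > 0 \<Longrightarrow> strong_feller E (P t)"
    and "jointly_continuous_semigroup E P"
    and "usual_conditions M \<F>"
    and "markov_process E P \<mu> M \<F> X"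
    and "AE \<omega> in M. cadlag E (\<lambda>t. X t \<omega>)"
    and "closedin E N"
    and "emeasure \<mu> N = 0"
    and "\<And>t x. t > 0 \<Longrightarrow> x \<in> topspace E \<Longrightarrow> emeasure (P t x) N = 0"
    and "measure M {\<omega> \<in> space M. hitting_time X N \<omega> < \<infinity>} > 0"
  shows "let F = topspace E - N;
             S = subtopology E F;
             Q = restrict_kernel P F
         in Polish_space S \<and>
            (markov_semigroup S Q \<and>
             (\<forall>t>0. strong_feller S (Q t)) \<and>
             jointly_continuous_semigroup S Q) \<and>
            (\<nexists>(M' :: 'v measure) \<F>' Y.
               markov_process S Q (restrict_space \<mu> F) M' \<F>' Y \<and>
               (AE \<omega> in M'. cadlag S (\<lambda>t. Y t \<omega>)))"
proof -
  define F where "F = topspace E - N"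
  define S where "S = subtopology E F"
  define Q where "Q = restrict_kernel P F"
  note semigroup = assms(2) and process = assms(8)
  have metrizable: "metrizable_space E"
    using assms(1) completely_metrizable_imp_metrizable_space by (auto simp: Polish_space_def)
  have F: "openin E F"
    unfolding F_def using assms(10) by (simp add: openin_diff)
  then have FB: "F \<in> sets (borel_of E)"
    by (rule borel_of_open)
  have N_eq: "topspace E - F = N"
    using closedin_subset[OF assms(10)] by (auto simp: F_def)
  have polish: "Polish_space S"
    using assms(1) F completely_metrizable_space_openin separable_space_open_subset
    unfolding Polish_space_def S_def by blast
  have Q: "markov_semigroup S Q"
    unfolding S_def Q_def
  proof (rule markov_semigroup_restrict[OF semigroup FB])
    fix t x assume "t > (0::real)" "x \<in> F"
    then show "emeasure (P t x) (topspace E - F) = 0"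
      unfolding N_eq by (intro assms(12)) (auto simp: F_def)
  qed
  have feller: "strong_feller S (Q t)" if "t > 0" for t
  proof -
    have "markov_kernel E (P t)"
      using semigroup that by (simp add: markov_semigroup_def)
    then show ?thesis
      unfolding S_def Q_def using FB assms(5)[OF that] by (rule strong_feller_restrict)
  qed
  have joint: "jointly_continuous_semigroup S Q"
    unfolding S_def Q_def
    by (rule jointly_continuous_restrict[OF metrizable semigroup assms(5,6) F])
  have no_process: False
    if Y: "markov_process S Q (restrict_space \<mu> F) M' \<F>' Y" and Y_cadlag: "AE \<omega> in M'. cadlag S (\<lambda>t. Y t \<omega>)"
    for M' :: "'v measure" and \<F>' Y
  proof -
    obtain C :: "nat \<Rightarrow> 'a set" where C: "incseq C" "\<And>k. closedin E (C k)" "\<And>k. C k \<inter> N = {}"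
      and ex: "\<And>x. x \<in> topspace E - N \<Longrightarrow> \<exists>U k. openin E U \<and> x \<in> U \<and> U \<subseteq> C k"
      by (rule closedin_metrizable_exhaustion[OF metrizable assms(10)]) blast
    have CF: "C k \<subseteq> F" for k
      using C(3)[of k] closedin_subset[OF C(2)[of k]] by (auto simp: F_def)
    have "AE \<omega> in M. \<forall>T. \<exists>k. \<forall>s\<in>dyadic_times T. X s \<omega> \<in> C k"
      using Q Y Y_cadlag C CF ex unfolding S_def Q_def
      by (intro AE_dyadic_values_in_exhaustion[OF semigroup process _ _ _ F assms(4)]) (auto simp: F_def)
    with assms(9) have "AE \<omega> in M. \<not> hitting_time X N \<omega> < \<infinity>"
    proof eventually_elim
      case (elim \<omega>)
      have "X t \<omega> \<notin> N" if "t > 0" for t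
        using cadlag_avoids_if_dyadic_values_avoid[OF elim(1) C, of t] elim(2) that by auto
      then have no_hit: "{ereal t |t. t > 0 \<and> X t \<omega> \<in> N} = {}"
        by auto
      have "hitting_time X N \<omega> = \<infinity>"
        unfolding hitting_time_def no_hit by (simp add: top_ereal_def)
      then show ?case
        by simp
    qed
    then have "AE \<omega> in M. \<omega> \<notin> {\<omega> \<in> space M. hitting_time X N \<omega> < \<infinity>}"
      by (rule AE_mp) auto
    \<comment> \<open>a set of positive \<^const>\<open>measure\<close> is measurable, since other sets are given the value \<open>0\<close>\<close>
    moreover have "{\<omega> \<in> space M. hitting_time X N \<omega> < \<infinity>} \<in> sets M"
      using assms(13) measure_notin_sets by fastforce
    ultimately have "emeasure M {\<omega> \<in> space M. hitting_time X N \<omega> < \<infinity>} = 0"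
      by (simp add: AE_iff_null_sets null_setsD1)
    then show False
      using assms(13) by (simp add: measure_def)
  qed
  show ?thesis
    unfolding Let_def F_def[symmetric] S_def[symmetric] Q_def[symmetric]
    using polish Q feller joint no_process by blast
qed

end
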